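(* If $q$ is a power of $2$ and $k\geq 3$ is an integer, then the curve $$\mathcal{F}: y^{q^k-1}=\dfrac{x^{q^k}-x}{x^q-x}$$ is $q^k$-Frobenius nonclassical. Moreover, if $q=2$ then $\mathcal{F}$ is smooth and does not have the arc property.
   Context: The curve is considered over $\mathbb{F}_{q^k}$, and smoothness and rational points refer to its projective closure in $\mathbb{P}^2$. For a prime power $Q$, an (absolutely) irreducible plane curve $F(x,y)=0$ with $F\in\mathbb{F}_Q[x,y]$ is called $Q$-Frobenius nonclassical if $F$ divides $(x^Q-x)\frac{\partial F}{\partial x}+(y^Q-y)\frac{\partial F}{\partial y}$. An $(N,d)$-arc is a set of $N$ points in the projective plane $PG(2,Q)$ over $\mathbb{F}_Q$ with at most $d$ points on any line and exactly $d$ points on some line; it is complete if it is not contained in an $(N+1,d)$-arc. If $\mathcal{F}$ is a projective plane curve of degree $d$ defined over $\mathbb{F}_Q$ that meets at least one line in $d$ distinct $\mathbb{F}_Q$-points, then the set $\mathcal{F}(\mathbb{F}_Q)$ of $\mathbb{F}_Q$-points of $\mathcal{F}$ is an $(N,d)$-arc with $N=\#\mathcal{F}(\mathbb{F}_Q)$; if this arc is complete, $\mathcal{F}$ is said to have the arc property. Here $Q=q^k$. *)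

theory Defs
  imports
    "HOL-Algebra.Algebraic_Closure_Type"
    "HOL-Library.Cardinality"
    "HOL-Computational_Algebra.Computational_Algebra"
begin

text \<open>
  A polynomial in \<open>x, y\<close> is an element of \<open>'a poly poly\<close>: the inner variable is \<open>x\<close>, the outer
  one is \<open>y\<close>, so \<open>coeff (coeff F j) i\<close> is the coefficient of \<open>x^i y^j\<close>.  A polynomial in
  \<open>x, y, z\<close> is an element of \<open>'a poly poly poly\<close> with outermost variable \<open>z\<close>.
  The field \<open>\<F>\<^sub>Q\<close> is a finite field type \<open>'a\<close> with \<open>CARD('a) = Q\<close>, and \<open>'a alg_closure\<close> is its
  algebraic closure.
\<close>

definition X2 :: "'a::comm_ring_1 poly poly" where
  "X2 = [:[:0, 1:]:]"

definition Y2 :: "'a::comm_ring_1 poly poly" where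
  "Y2 = [:0, 1:]"

definition dX2 :: "'a::idom poly poly \<Rightarrow> 'a poly poly" where
  "dX2 F = map_poly pderiv F"

definition dY2 :: "'a::idom poly poly \<Rightarrow> 'a poly poly" where
  "dY2 F = pderiv F"

definition total_degree :: "'a::zero poly poly \<Rightarrow> nat" where
  "total_degree F = Max (insert 0 {i + j | i j. coeff (coeff F j) i \<noteq> 0})"

definition absolutely_irreducible :: "'a::field poly poly \<Rightarrow> bool" where
  "absolutely_irreducible F \<longleftrightarrow>
     Factorial_Ring.irreducible (map_poly (map_poly to_ac) F :: 'a alg_closure poly poly)"

definition frobenius_nonclassical :: "'a::{field,finite} poly poly \<Rightarrow> bool" where
  "frobenius_nonclassical F \<longleftrightarrow>
     absolutely_irreducible F \<and>
     F dvd (X2 ^ CARD('a) - X2) * dX2 F + (Y2 ^ CARD('a) - Y2) * dY2 F"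

definition homogenize :: "'a::comm_ring_1 poly poly \<Rightarrow> 'a poly poly poly" where
  "homogenize F =
     (\<Sum>j\<le>degree F. \<Sum>i\<le>degree (coeff F j).
        monom (monom (monom (coeff (coeff F j) i) i) j) (total_degree F - (i + j)))"

definition eval3 :: "'a::comm_ring_1 poly poly poly \<Rightarrow> 'a \<Rightarrow> 'a \<Rightarrow> 'a \<Rightarrow> 'a" where
  "eval3 G x y z = poly (poly (poly G [:[:z:]:]) [:y:]) x"

definition dX3 :: "'a::idom poly poly poly \<Rightarrow> 'a poly poly poly" where
  "dX3 G = map_poly (map_poly pderiv) G"

definition dY3 :: "'a::idom poly poly poly \<Rightarrow> 'a poly poly poly" where
  "dY3 G = map_poly pderiv G"

definition dZ3 :: "'a::idom poly poly poly \<Rightarrow> 'a poly poly poly" where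
  "dZ3 G = pderiv G"

definition smooth_closure :: "'a::field poly poly \<Rightarrow> bool" where
  "smooth_closure F \<longleftrightarrow>
     (let G = map_poly (map_poly (map_poly to_ac)) (homogenize F) :: 'a alg_closure poly poly poly
      in \<not> (\<exists>x y z. (x, y, z) \<noteq> (0, 0, 0) \<and> eval3 G x y z = 0 \<and>
               eval3 (dX3 G) x y z = 0 \<and> eval3 (dY3 G) x y z = 0 \<and> eval3 (dZ3 G) x y z = 0))"

text \<open>
  A point \<open>(x : y : z)\<close> of \<open>PG(2,Q)\<close> is represented by its class of homogeneous coordinate triples,
  and a line by the set of points on it.
\<close>

definition proj_point :: "'a::field \<Rightarrow> 'a \<Rightarrow> 'a \<Rightarrow> ('a \<times> 'a \<times> 'a) set" where
  "proj_point x y z = {(c * x, c * y, c * z) | c. c \<noteq> 0}"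

definition pg2_points :: "('a::field \<times> 'a \<times> 'a) set set" where
  "pg2_points = {proj_point x y z | x y z. (x, y, z) \<noteq> (0, 0, 0)}"

definition pg2_lines :: "('a::field \<times> 'a \<times> 'a) set set set" where
  "pg2_lines =
     {{proj_point x y z | x y z. (x, y, z) \<noteq> (0, 0, 0) \<and> a * x + b * y + c * z = 0} | a b c.
        (a, b, c) \<noteq> (0, 0, 0)}"

definition is_arc :: "nat \<Rightarrow> nat \<Rightarrow> ('a::{field,finite} \<times> 'a \<times> 'a) set set \<Rightarrow> bool" where
  "is_arc N d A \<longleftrightarrow>
     A \<subseteq> pg2_points \<and> card A = N \<and>
     (\<forall>L\<in>pg2_lines. card (A \<inter> L) \<le> d) \<and> (\<exists>L\<in>pg2_lines. card (A \<inter> L) = d)"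

definition is_complete_arc :: "nat \<Rightarrow> nat \<Rightarrow> ('a::{field,finite} \<times> 'a \<times> 'a) set set \<Rightarrow> bool" where
  "is_complete_arc N d A \<longleftrightarrow> is_arc N d A \<and> \<not> (\<exists>B. is_arc (N + 1) d B \<and> A \<subseteq> B)"

definition rational_points :: "'a::field poly poly \<Rightarrow> ('a \<times> 'a \<times> 'a) set set" where
  "rational_points F =
     {proj_point x y z | x y z. (x, y, z) \<noteq> (0, 0, 0) \<and> eval3 (homogenize F) x y z = 0}"

text \<open>The degree of the projective closure of \<open>F = 0\<close> is \<open>total_degree F\<close>.\<close>

definition has_arc_property :: "'a::{field,finite} poly poly \<Rightarrow> bool" where
  "has_arc_property F \<longleftrightarrow>
     (\<exists>L\<in>pg2_lines. card (rational_points F \<inter> L) = total_degree F) \<and>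
     is_complete_arc (card (rational_points F)) (total_degree F) (rational_points F)"

text \<open>
  The curve \<open>y^(q^k - 1) = (x^(q^k) - x) / (x^q - x)\<close>; the quotient is a polynomial by the
  lemma below, so \<open>div\<close> is exact division.
\<close>

definition curve_poly :: "nat \<Rightarrow> nat \<Rightarrow> 'a::field poly poly" where
  "curve_poly q k =
     monom 1 (q ^ k - 1) -
     [:(monom 1 (q ^ k) - monom 1 1) div (monom 1 q - monom 1 1):]"

lemma curve_quotient_exact:
  fixes q k :: nat
  assumes "q \<ge> 1"
  shows "(monom 1 q - monom 1 1 :: 'a::field poly) dvd monom 1 (q ^ k) - monom 1 1"
proof -
  have split: "monom 1 n - monom 1 1 = (monom 1 1 :: 'a poly) * (monom 1 (n - 1) - 1)" if "n \<ge> 1" for n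
    using that by (simp add: algebra_simps mult_monom)
  have "(q - 1) dvd (q ^ k - 1)"
  proof (induction k)
    case (Suc k)
    have "q ^ Suc k - 1 = q * (q ^ k - 1) + (q - 1)"
      using assms by (simp add: algebra_simps)
    then show ?case using Suc by simp
  qed simp
  then obtain m where m: "q ^ k - 1 = (q - 1) * m" by blast
  have "(monom 1 (q - 1) - 1 :: 'a poly) dvd monom 1 (q - 1) ^ m - 1 ^ m"
    by (metis dvd_def power_diff_sumr2)
  then have "(monom 1 (q - 1) - 1 :: 'a poly) dvd monom 1 (q ^ k - 1) - 1"
    unfolding m by (simp add: monom_power)
  then show ?thesis
    using assms split[of q] split[of "q ^ k"]
    by (simp only: one_le_power mult_dvd_mono dvd_refl)
qed

end

theory Submission
  imports Defs
begin

text \<open>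
  Write \<open>Q = q^k\<close>, \<open>P = (x^Q - x) / (x^q - x)\<close> and \<open>w = y^(Q - 1)\<close>, so that the curve is
  \<open>w = P\<close>. Every root of \<open>P\<close> is simple, since \<open>x^Q - x\<close> has derivative \<open>-1\<close>; Eisenstein's argument
  at such a root gives absolute irreducibility. Differentiating \<open>P (x^q - x) = x^Q - x\<close> yields
  \<open>(x^Q - x) P' = P (P - 1)\<close>, and as \<open>Q - 1 = 1\<close> in characteristic 2 the Frobenius polynomial is
  \<open>w (w - 1) - P (P - 1) = (w - P) (w + P - 1)\<close>.

  For \<open>q = 2\<close> the homogeneous equation \<open>G\<close> of degree \<open>n = Q - 1\<close> satisfies
  \<open>(x - z) (y^n - G) = z (x^n - z^n)\<close>. A singular point has \<open>y = 0\<close> because \<open>n\<close> is odd, and the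
  \<open>z\<close>-derivative of this identity then forces \<open>x = 0\<close>, hence \<open>z = 0\<close>. At a rational point the
  identity forces \<open>x = 0\<close>, \<open>y = 0\<close> or \<open>x = z\<close>. For \<open>t\<close> different from \<open>0, 1\<close> the point
  \<open>(t : 1 : 1)\<close> is off these three lines, so every line through it meets the arc in at most
  \<open>3 < n\<close> points, and the arc can be extended by it.
\<close>

section \<open>Homomorphisms on coefficients, and Eisenstein's criterion\<close>

lemma map_poly_add_hom:
  assumes "f 0 = 0" "\<And>x y. f (x + y) = f x + f y"
  shows "map_poly f (p + q) = map_poly f p + map_poly f q"
  by (intro poly_eqI) (simp add: coeff_map_poly assms)

lemma map_poly_diff_hom:
  assumes "f 0 = 0" "\<And>x y. f (x - y) = f x - f y"
  shows "map_poly f (p - q) = map_poly f p - map_poly f q"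
  by (intro poly_eqI) (simp add: coeff_map_poly assms)

lemma map_poly_sum_hom:
  assumes "f 0 = 0" "\<And>x y. f (x + y) = f x + f y"
  shows "map_poly f (\<Sum>i\<in>A. p i) = (\<Sum>i\<in>A. map_poly f (p i))"
  by (induction A rule: infinite_finite_induct) (simp_all add: map_poly_add_hom[OF assms] assms(1))

lemma map_poly_mult_hom:
  fixes f :: "'a::comm_ring_1 \<Rightarrow> 'b::comm_ring_1"
  assumes f: "f 0 = 0" "\<And>x y. f (x + y) = f x + f y" "\<And>x y. f (x * y) = f x * f y"
  shows "map_poly f (p * q) = map_poly f p * map_poly f q"
proof (induction p)
  case (pCons a p)
  then show ?case
    by (simp add: map_poly_pCons map_poly_add_hom map_poly_smult f)
qed simp

text \<open>
  Eisenstein's criterion at the prime \<open>x - a\<close>: modulo \<open>x - a\<close> a nontrivial factorization becomes one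
  of \<open>y^n\<close>, so both constant terms vanish at \<open>a\<close>, and \<open>p\<close> has a double root there.
\<close>

lemma irreducible_monom_minus_const:
  fixes p :: "'a::field poly"
  assumes n: "n \<ge> 1" and root: "poly p a = 0" and simple: "poly (pderiv p) a \<noteq> 0"
  shows "Factorial_Ring.irreducible (monom 1 n - [:p:])"
proof -
  define F where "F = monom 1 n - [:p:]"
  have cF: "coeff F j = (if j = n then 1 else if j = 0 then - p else 0)" for j
    using n by (auto simp: F_def coeff_pCons split: nat.splits)
  have dF: "degree F = n"
    by (intro antisym degree_le le_degree) (auto simp: cF)
  have lF: "lead_coeff F = 1"
    by (simp add: dF cF)
  have F0: "F \<noteq> 0"
    using lF by auto
  \<comment> \<open>As \<open>F\<close> is monic in y, a factor free of y is an invertible constant;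
    a nontrivial factorization therefore has positive y-degrees on both sides.\<close>
  have unit: "G dvd 1" if "F = G * H" "degree G = 0" for G H
  proof -
    obtain g where g: "G = [:g:]"
      using \<open>degree G = 0\<close> by (rule degree_eq_zeroE)
    have "lead_coeff G * lead_coeff H = 1"
      using lF that(1) by (simp add: lead_coeff_mult)
    then have "g dvd 1"
      unfolding g by (intro dvdI[of 1 g "lead_coeff H"]) simp
    then show ?thesis
      by (simp add: g is_unit_const_poly_iff)
  qed
  define r where "r = map_poly (\<lambda>c. poly c a)"
  have r_mult: "r (A * B) = r A * r B" for A B
    unfolding r_def by (rule map_poly_mult_hom) auto
  have vanish: "poly (coeff G 0) a = 0" if F: "F = G * H" and pos: "degree G > 0" for G H
  proof -
    have "lead_coeff G * lead_coeff H = 1"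
      using lF F by (simp add: lead_coeff_mult)
    from arg_cong[OF this, of "\<lambda>p. poly p a"]
    have lc: "poly (lead_coeff G) a * poly (lead_coeff H) a = 1"
      by simp
    \<comment> \<open>The leading coefficients have product 1, so neither vanishes at
      \<open>a\<close> and reduction keeps both degrees.\<close>
    have dG: "degree (r G) = degree G" and dH: "degree (r H) = degree H"
      unfolding r_def using lc by (auto intro!: map_poly_degree_eq)
    have "r F = monom 1 n"
      by (intro poly_eqI) (simp add: r_def coeff_map_poly cF root)
    then have prod: "r G * r H = monom 1 n"
      by (simp add: F r_mult)
    then have nz: "r G * r H \<noteq> 0"
      by simp
    \<comment> \<open>The orders at 0 and the degrees both add up to \<open>n\<close>, and
      \<open>r H\<close> has order at most its degree; hence the order of \<open>r G\<close> is at
      least its degree, which is positive.\<close>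
    have "order 0 (r G) + order 0 (r H) = n"
      using prod order_mult[OF nz, of 0] by (simp add: order_0_monom)
    moreover have "degree (r G * r H) = degree (r G) + degree (r H)"
      using nz by (intro degree_mult_eq) auto
    then have "degree (r G) + degree (r H) = n"
      unfolding prod by (simp add: degree_monom_eq)
    moreover have "order 0 (r H) \<le> degree (r H)"
      using nz by (intro order_degree) auto
    ultimately have "order 0 (r G) \<noteq> 0"
      using dG pos by linarith
    then have "poly (r G) 0 = 0"
      using order_root by blast
    then show ?thesis
      by (simp add: poly_0_coeff_0 r_def coeff_map_poly)
  qed
  show ?thesis
    unfolding F_def[symmetric]
  proof (rule Factorial_Ring.irreducibleI)
    show "F \<noteq> 0" by fact
    show "\<not> F dvd 1"
      using dvd_imp_degree_le[of F 1] n dF by auto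
    fix G H assume F: "F = G * H"
    show "G dvd 1 \<or> H dvd 1"
    proof (rule ccontr)
      assume no_unit: "\<not> (G dvd 1 \<or> H dvd 1)"
      have F': "F = H * G"
        using F by (simp add: mult.commute)
      have "degree G > 0" "degree H > 0"
        using no_unit unit[OF F] unit[OF F'] by auto
      then have z: "poly (coeff G 0) a = 0" "poly (coeff H 0) a = 0"
        using vanish[OF F] vanish[OF F'] by auto
      have "coeff G 0 * coeff H 0 = - p"
        using cF[of 0] n F by (simp add: coeff_mult)
      then have "pderiv p = - pderiv (coeff G 0 * coeff H 0)"
        by (simp add: pderiv_minus)
      then have "poly (pderiv p) a = 0"
        using z by (simp add: pderiv_mult)
      with simple show False
        by simp
    qed
  qed
qed

section \<open>Fermat's theorem and the characteristic of a finite field\<close>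

text \<open>Multiplication by \<open>x\<close> permutes the nonzero elements, so their product
  absorbs the factor \<open>x ^ (CARD('a) - 1)\<close>.\<close>

lemma finite_field_power_CARD:
  fixes x :: "'a::{field,finite}"
  assumes "x \<noteq> 0"
  shows "x ^ (CARD('a) - 1) = 1"
proof -
  have bij: "bij_betw ((*) x) (UNIV - {0}) (UNIV - {0})"
    by (rule bij_betwI[where g = "\<lambda>y. y / x"]) (use assms in auto)
  have "(\<Prod>y\<in>UNIV - {0::'a}. y) = (\<Prod>y\<in>UNIV - {0}. x * y)"
    using prod.reindex_bij_betw[OF bij, of "\<lambda>y. y"] by simp
  also have "\<dots> = x ^ (CARD('a) - 1) * (\<Prod>y\<in>UNIV - {0}. y)"
    by (simp add: prod.distrib card_Diff_subset)
  finally show ?thesis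
    by simp
qed

text \<open>Translation by 1 permutes the field, so the sum of all elements does not change when
  \<open>CARD('a)\<close> ones are added. The characteristic is thus a prime dividing a power of
  2.\<close>

lemma CHAR_eq_2:
  assumes "CARD('a::{field,finite}) = 2 ^ n"
  shows "CHAR('a) = 2"
proof -
  have "sum (\<lambda>y::'a. y) UNIV = sum (\<lambda>y. 1 + y) UNIV"
    by (rule sum.reindex_bij_witness[where i = "\<lambda>y. 1 + y" and j = "\<lambda>y. y - 1"]) auto
  then have "of_nat CARD('a) = (0::'a)"
    by (simp add: sum.distrib)
  then have "CHAR('a) dvd 2 ^ n"
    using assms of_nat_eq_0_iff_char_dvd by metis
  moreover have "prime CHAR('a)"
    by (intro prime_CHAR_semidom finite_imp_CHAR_pos) auto
  ultimately show ?thesis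
    by (metis prime_dvd_power primes_dvd_imp_eq two_is_prime_nat)
qed

section \<open>Absolute irreducibility and Frobenius nonclassicality\<close>

lemma curve_quotient_mult:
  assumes "q \<ge> 1"
  shows "(monom 1 (q ^ k) - monom 1 1) div (monom 1 q - monom 1 1) * (monom 1 q - monom 1 1 :: 'a::field poly)
    = monom 1 (q ^ k) - monom 1 1"
  using curve_quotient_exact[OF assms, of k] by (rule dvd_div_mult_self)

lemma pderiv_monom_minus_X:
  assumes "(of_nat q :: 'a::idom) = 0"
  shows "pderiv (monom 1 q - monom 1 1 :: 'a poly) = - 1"
  using assms by (simp add: pderiv_diff pderiv_monom flip: one_poly_eq_simps(1) monom_0)

lemma absolutely_irreducible_curve_poly:
  fixes q k :: nat
  assumes q: "q \<ge> 2" and k: "k \<ge> 2" and char: "(of_nat q :: 'a::field) = 0"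
  shows "absolutely_irreducible (curve_poly q k :: 'a poly poly)"
proof -
  define P :: "'a poly" where "P = (monom 1 (q ^ k) - monom 1 1) div (monom 1 q - monom 1 1)"
  define R where "R = map_poly to_ac P"
  have qk: "q < q ^ k"
    using power_strict_increasing[of 1 k q] q k by simp
  have "P * (monom 1 q - monom 1 1) = monom 1 (q ^ k) - monom 1 1"
    using curve_quotient_mult[of q k] q by (simp add: P_def)
  from arg_cong[OF this, of "map_poly to_ac"]
  have R: "R * (monom 1 q - monom 1 1) = monom 1 (q ^ k) - monom 1 1"
    by (simp add: map_poly_mult_hom map_poly_diff_hom map_poly_monom R_def)
  have deg: "degree (monom 1 m - monom 1 1 :: 'a alg_closure poly) = m" if "m \<ge> 2" for m
    using that by (intro antisym degree_le le_degree) auto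
  have "degree (R * (monom 1 q - monom 1 1)) = q ^ k"
    using qk q R deg[of "q ^ k"] by simp
  \<comment> \<open>The factor \<open>monom 1 q - monom 1 1\<close> accounts for only q of the total
    degree \<open>q ^ k\<close>.\<close>
  then have "degree R > 0"
    using degree_mult_le[of R "monom 1 q - monom 1 1"] deg[of q] qk q by linarith
  then obtain a where a: "poly R a = 0"
    using alg_closed_imp_poly_has_root by blast
  have char': "(of_nat q :: 'a alg_closure) = 0"
    using char by (metis to_ac_0 to_ac_of_nat)
  have "poly (pderiv (R * (monom 1 q - monom 1 1))) a = poly (pderiv (monom 1 (q ^ k) - monom 1 1)) a"
    by (simp only: R)
  \<comment> \<open>The other term of the product rule contains R(a) = 0. A product equal to -1 has
    no zero factor, so the root \<open>a\<close> is simple.\<close>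
  then have "poly (pderiv R) a * poly (monom 1 q - monom 1 1) a = - 1"
    using a k pderiv_monom_minus_X[OF char'] pderiv_monom_minus_X[of "q ^ k", where 'a = "'a alg_closure"] char'
    by (simp add: pderiv_mult mult.commute)
  then have "poly (pderiv R) a \<noteq> 0"
    by auto
  moreover have "q ^ k - 1 \<ge> 1"
    using qk q by linarith
  ultimately have "Factorial_Ring.irreducible (monom 1 (q ^ k - 1) - [:R:])"
    using a by (intro irreducible_monom_minus_const)
  moreover have "map_poly (map_poly to_ac) (curve_poly q k) = monom 1 (q ^ k - 1) - [:R:]"
    unfolding curve_poly_def P_def[symmetric] R_def
    by (simp add: map_poly_diff_hom map_poly_monom map_poly_pCons)
  ultimately show ?thesis
    by (simp add: absolutely_irreducible_def)
qed

lemma frobenius_nonclassical_curve_poly: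
  fixes q k :: nat
  assumes q: "q \<ge> 2" "even q" and k: "k \<ge> 2" and card: "CARD('a::{field,finite}) = q ^ k"
    and char: "CHAR('a) = 2"
  shows "frobenius_nonclassical (curve_poly q k :: 'a poly poly)"
proof -
  define P :: "'a poly" where "P = (monom 1 (q ^ k) - monom 1 1) div (monom 1 q - monom 1 1)"
  define Q where "Q = q ^ k"
  define w :: "'a poly poly" where "w = Y2 ^ (Q - 1)"
  have two: "of_nat n = (0::'a) \<longleftrightarrow> even n" for n
    using char by (simp add: of_nat_eq_0_iff_char_dvd)
  have "4 \<le> q ^ 2"
    using power_mono[of 2 q 2] q by simp
  also have "\<dots> \<le> Q"
    unfolding Q_def using q k by (intro power_increasing) auto
  finally have Q: "Q \<ge> 4" "even Q"
    using q k by (simp_all add: Q_def)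
  have P: "P * (monom 1 q - monom 1 1) = monom 1 Q - monom 1 1"
    using curve_quotient_mult[of q k] q by (simp add: P_def Q_def)
  have "pderiv P * (monom 1 q - monom 1 1) - P = - 1"
    using arg_cong[OF P, of pderiv] pderiv_monom_minus_X[of q, where 'a = 'a]
      pderiv_monom_minus_X[of Q, where 'a = 'a] two q Q
    by (simp add: pderiv_mult mult.commute)
  then have P': "pderiv P * (monom 1 q - monom 1 1) = P - 1"
    by (simp add: algebra_simps)
  \<comment> \<open>Multiplying \<open>P'\<close> by \<open>P\<close> turns x^q - x into x^Q - x,
    the factor that accompanies the x-derivative in the Frobenius condition.\<close>
  have dP: "(monom 1 Q - monom 1 1) * pderiv P = P * (P - 1)"
    unfolding P[symmetric] P'[symmetric] by (simp add: mult_ac)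
  have F: "curve_poly q k = w - [:P:]"
    by (simp add: curve_poly_def P_def Q_def w_def Y2_def monom_altdef)
  have "dX2 (monom 1 (Q - 1) - [:P:]) = - [:pderiv P:]"
    unfolding dX2_def
    by (subst map_poly_diff_hom) (simp_all add: pderiv_diff map_poly_monom map_poly_pCons)
  then have dX: "dX2 (w - [:P:]) = - [:pderiv P:]"
    by (simp add: w_def Y2_def monom_altdef)
  \<comment> \<open>Oddness makes the exponent Q - 1 equal to 1 in the field, so the y-derivative of
    \<open>w\<close> carries no scalar.\<close>
  have "odd (Q - 1)"
    using Q by simp
  then obtain m where m: "Q - 1 = 2 * m + 1"
    by (rule oddE)
  have "of_nat (Q - 1) = (1 :: 'a)"
    unfolding m of_nat_add using two[of "2 * m"] by simp
  then have "of_nat (Q - 1) = (1 :: 'a poly)"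
    unfolding of_nat_poly by (simp add: one_pCons)
  then have dY: "dY2 (w - [:P:]) = Y2 ^ (Q - 2)"
    by (simp add: dY2_def w_def Y2_def pderiv_diff pderiv_power pderiv_pCons numeral_2_eq_2)
  have X: "X2 ^ Q - X2 = [:monom 1 Q - monom 1 1 :: 'a poly:]"
    by (simp add: X2_def monom_altdef poly_const_pow)
  have Y: "(Y2 ^ Q - Y2) * Y2 ^ (Q - 2) = w * w - (w :: 'a poly poly)"
  proof -
    obtain m where "Q = m + 2"
      using Q(1) by (metis add.commute le_Suc_ex numeral_Bit0 numeral_plus_numeral semiring_norm(2) add_leD2)
    then show ?thesis
      by (simp add: w_def algebra_simps power_add)
  qed
  have "(X2 ^ Q - X2) * dX2 (w - [:P:]) + (Y2 ^ Q - Y2) * dY2 (w - [:P:])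
    = (w * w - w) - [:P:] * ([:P:] - 1)"
    unfolding dX dY X Y using dP by (simp add: one_pCons mult.commute)
  also have "\<dots> = (w - [:P:]) * (w + [:P:] - 1)"
    by (simp add: algebra_simps)
  finally have "w - [:P:] dvd (X2 ^ Q - X2) * dX2 (w - [:P:]) + (Y2 ^ Q - Y2) * dY2 (w - [:P:])"
    by simp
  then show ?thesis
    using absolutely_irreducible_curve_poly[OF q(1) k, where 'a = 'a] two[of q] q(2)
    unfolding frobenius_nonclassical_def card Q_def[symmetric] by (simp add: F)
qed

section \<open>The explicit affine and homogeneous equations for q = 2\<close>

text \<open>The curve for q = 2 when n = 2^k - 1, free of division so that coefficients can be read
  off.\<close>

definition geo_curve :: "nat \<Rightarrow> 'a::comm_ring_1 poly poly" where
  "geo_curve n = monom 1 n - [:\<Sum>i<n. monom 1 i:]"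

text \<open>Stated over any commutative ring, so that one formula serves over the finite field and
  over its algebraic closure.\<close>

definition hcurve :: "nat \<Rightarrow> 'a::comm_ring_1 poly poly poly" where
  "hcurve n = monom (monom (monom 1 0) n) 0 - (\<Sum>i<n. monom (monom (monom 1 i) 0) (n - i))"

text \<open>Cancelling x from numerator and denominator leaves (x^n - 1) / (x - 1), a geometric
  sum.\<close>

lemma curve_poly_2: "curve_poly 2 k = (geo_curve (2 ^ k - 1) :: 'a::field poly poly)"
proof -
  define n :: nat where "n = 2 ^ k - 1"
  have n: "2 ^ k = Suc n"
    by (simp add: n_def)
  define x :: "'a poly" where "x = monom 1 1"
  have x: "monom 1 i = x ^ i" for i
    by (simp add: x_def monom_power)
  have "(\<Sum>i<n. x ^ i) * (x ^ 2 - x) = x * ((x - 1) * (\<Sum>i<n. x ^ i))"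
    by (simp add: algebra_simps power2_eq_square)
  also have "\<dots> = x ^ Suc n - x"
    by (simp only: power_diff_1_eq[symmetric]) (simp add: algebra_simps)
  finally have eq: "x ^ Suc n - x = (\<Sum>i<n. x ^ i) * (x ^ 2 - x)"
    by simp
  have "coeff (x ^ 2 - x) 2 = 1"
    by (simp add: x_def monom_power)
  then have "x ^ 2 - x \<noteq> 0"
    by auto
  then have "(x ^ Suc n - x) div (x ^ 2 - x) = (\<Sum>i<n. x ^ i)"
    unfolding eq by (rule nonzero_mult_div_cancel_right)
  then show ?thesis
    unfolding curve_poly_def geo_curve_def n x by simp
qed

lemma coeff_geo_curve:
  assumes "n \<ge> 1"
  shows "coeff (coeff (geo_curve n :: 'a::comm_ring_1 poly poly) j) i
    = (if j = n \<and> i = 0 then 1 else if j = 0 \<and> i < n then - 1 else 0)"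
proof -
  have "coeff (\<Sum>i<n. monom (1::'a) i) i = (if i < n then 1 else 0)"
    by (simp add: coeff_sum)
  then show ?thesis
    using assms by (cases j) (auto simp: geo_curve_def)
qed

lemma total_degree_geo_curve:
  assumes "n \<ge> 1"
  shows "total_degree (geo_curve n :: 'a::comm_ring_1 poly poly) = n"
proof -
  define S where "S = {i + j | i j. coeff (coeff (geo_curve n :: 'a poly poly) j) i \<noteq> 0}"
  have sub: "S \<subseteq> {..n}"
    by (auto simp: S_def coeff_geo_curve[OF assms] split: if_splits)
  have "n \<in> S"
    unfolding S_def using coeff_geo_curve[OF assms, of n 0, where 'a = 'a]
    by (intro CollectI exI[of _ 0] exI[of _ n]) simp
  then show ?thesis
    unfolding total_degree_def S_def[symmetric]
    using sub by (intro Max_eqI) (auto intro: finite_subset)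
qed

lemma homogenize_geo_curve:
  assumes n: "n \<ge> 1"
  shows "homogenize (geo_curve n :: 'a::comm_ring_1 poly poly) = hcurve n"
proof -
  define F :: "'a poly poly" where "F = geo_curve n"
  have cF: "coeff (coeff F j) i = (if j = n \<and> i = 0 then 1 else if j = 0 \<and> i < n then - 1 else 0)" for i j
    by (simp add: F_def coeff_geo_curve[OF n])
  have tF: "total_degree F = n"
    by (simp add: F_def total_degree_geo_curve[OF n])
  have dF: "degree F = n"
    by (intro antisym degree_le le_degree) (auto simp: poly_eq_iff cF)
  have d0: "degree (coeff F 0) = n - 1"
    using n by (intro antisym degree_le le_degree) (auto simp: cF)
  have d: "degree (coeff F j) = 0" if "j > 0" for j
    using that degree_le[of 0 "coeff F j"] by (simp add: cF)
  define T where "T j = (\<Sum>i\<le>degree (coeff F j). monom (monom (monom (coeff (coeff F j) i) i) j) (n - (i + j)))" for j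
  have "homogenize F = (\<Sum>j\<le>n. T j)"
    by (simp add: homogenize_def tF dF T_def)
  \<comment> \<open>Only the powers y^0 and y^n occur in the equation.\<close>
  also have "\<dots> = (\<Sum>j\<in>{0, n}. T j)"
    using n by (intro sum.mono_neutral_right) (auto simp: T_def d cF)
  also have "\<dots> = T 0 + T n"
    using n by simp
  also have "T n = monom (monom (monom 1 0) n) 0"
    using n by (simp add: T_def d cF)
  also have "T 0 = (\<Sum>i<n. monom (monom (monom (- 1) i) 0) (n - i))"
    unfolding T_def d0 using n by (intro sum.cong) (auto simp: cF)
  also have "\<dots> = - (\<Sum>i<n. monom (monom (monom 1 i) 0) (n - i))"
    by (simp only: sum_negf minus_monom[symmetric])
  finally show ?thesis
    by (simp add: F_def hcurve_def)
qed

lemma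
  assumes "k \<ge> 1"
  shows total_degree_curve_poly_2: "total_degree (curve_poly 2 k :: 'a::field poly poly) = 2 ^ k - 1"
    and homogenize_curve_poly_2: "homogenize (curve_poly 2 k :: 'a poly poly) = hcurve (2 ^ k - 1)"
proof -
  have "2 ^ k - 1 \<ge> (1::nat)"
    using power_increasing[of 1 k "2::nat"] assms by simp
  then show "total_degree (curve_poly 2 k :: 'a::field poly poly) = 2 ^ k - 1"
    and "homogenize (curve_poly 2 k :: 'a poly poly) = hcurve (2 ^ k - 1)"
    unfolding curve_poly_2 by (rule total_degree_geo_curve, rule homogenize_geo_curve)
qed

section \<open>Evaluation, partial derivatives and smoothness for q = 2\<close>

lemma map_poly_hcurve:
  "map_poly (map_poly (map_poly to_ac)) (hcurve n) = hcurve n"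
  by (simp add: hcurve_def map_poly_diff_hom map_poly_sum_hom map_poly_add_hom map_poly_monom)

lemma eval3_diff: "eval3 (A - B) x y z = eval3 A x y z - eval3 B x y z"
  by (simp add: eval3_def)

lemma eval3_mult: "eval3 (A * B) x y z = eval3 A x y z * eval3 B x y z"
  by (simp add: eval3_def)

lemma eval3_of_nat: "eval3 (of_nat n) x y z = of_nat n"
  by (simp add: eval3_def)

lemma eval3_monom: "eval3 (monom (monom (monom c i) j) l) x y z = c * x ^ i * y ^ j * z ^ l"
  by (simp add: eval3_def poly_monom poly_const_pow mult_ac)

definition X3 :: "'a::comm_ring_1 poly poly poly" where
  "X3 = monom (monom (monom 1 1) 0) 0"

definition Y3 :: "'a::comm_ring_1 poly poly poly" where
  "Y3 = monom (monom (monom 1 0) 1) 0"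

definition Z3 :: "'a::comm_ring_1 poly poly poly" where
  "Z3 = monom (monom (monom 1 0) 0) 1"

text \<open>The geometric sum telescopes. As an identity of polynomials, not just of values, it can
  be differentiated as well as evaluated.\<close>

lemma hcurve_times_X_minus_Z:
  "(X3 - Z3) * (Y3 ^ n - hcurve n) = Z3 * (X3 ^ n - Z3 ^ n)"
proof -
  have "Y3 ^ n - hcurve n = (\<Sum>i<n. monom (monom (monom (1::'a) i) 0) (n - i))"
    by (simp add: hcurve_def Y3_def monom_power)
  also have "\<dots> = (\<Sum>i<n. Z3 * (Z3 ^ (n - Suc i) * X3 ^ i))"
    by (intro sum.cong) (auto simp: Z3_def X3_def monom_power mult_monom Suc_diff_Suc)
  also have "\<dots> = Z3 * (\<Sum>i<n. Z3 ^ (n - Suc i) * X3 ^ i)"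
    by (simp add: sum_distrib_left)
  finally show ?thesis
    by (simp add: power_diff_sumr2 mult_ac)
qed

lemma eval3_power: "eval3 (A ^ n) x y z = eval3 A x y z ^ n"
  by (simp add: eval3_def)

lemma eval3_coords: "eval3 X3 x y z = x" "eval3 Y3 x y z = y" "eval3 Z3 x y z = z"
  unfolding X3_def Y3_def Z3_def eval3_monom by simp_all

lemmas eval3_simps = eval3_diff eval3_mult eval3_power eval3_of_nat eval3_coords

lemma eval3_hcurve:
  "(x - z) * (y ^ n - eval3 (hcurve n) x y z) = z * (x ^ n - z ^ n)"
  using arg_cong[OF hcurve_times_X_minus_Z[of n], of "\<lambda>A. eval3 A x y z"]
  by (simp only: eval3_simps)

lemma eval3_dY3_hcurve:
  "eval3 (dY3 (hcurve n)) x y z = of_nat n * y ^ (n - 1)"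
proof -
  have "dY3 (hcurve n) = monom (monom (monom (of_nat n :: 'a) 0) (n - 1)) 0"
    by (simp add: dY3_def hcurve_def map_poly_diff_hom map_poly_sum_hom map_poly_monom pderiv_diff
        pderiv_add pderiv_monom map_poly_pCons pderiv_pCons of_nat_poly monom_0)
  then show ?thesis
    by (simp only: eval3_monom) simp
qed

text \<open>This is the z-derivative of the telescoped identity, evaluated at a point. The
  coefficient stays in the form \<open>of_nat (Suc n)\<close> because its parity decides whether the
  last term survives.\<close>

lemma eval3_dZ3_hcurve:
  fixes x :: "'a::idom"
  shows "(x - z) * eval3 (dZ3 (hcurve n)) x y z =
    eval3 (hcurve n) x y z - y ^ n - x ^ n + of_nat (Suc n) * z ^ n"
proof -
  have X: "pderiv (X3 :: 'a poly poly poly) = 0" and Y: "pderiv (Y3 :: 'a poly poly poly) = 0"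
    and Z: "pderiv (Z3 :: 'a poly poly poly) = 1"
    by (simp_all add: X3_def Y3_def Z3_def pderiv_monom)
  define H :: "'a poly poly poly" where "H = hcurve n"
  have "pderiv ((X3 - Z3) * (Y3 ^ n - H)) = (Z3 - X3) * dZ3 H - (Y3 ^ n - H)"
    by (simp add: pderiv_mult pderiv_diff pderiv_power X Y Z dZ3_def) (simp add: algebra_simps)
  moreover have "pderiv (Z3 * X3 ^ n - Z3 ^ Suc n) = X3 ^ n - of_nat (Suc n) * (Z3 ^ n :: 'a poly poly poly)"
    by (simp add: pderiv_mult pderiv_diff pderiv_power pderiv_power_Suc of_nat_mult_conv_smult X Z del: power_Suc of_nat_Suc)
  moreover have "(X3 - Z3) * (Y3 ^ n - H) = Z3 * X3 ^ n - Z3 ^ Suc n"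
    unfolding H_def hcurve_times_X_minus_Z by (simp add: right_diff_distrib)
  ultimately have "(Z3 - X3) * dZ3 (hcurve n) - (Y3 ^ n - hcurve n) = X3 ^ n - of_nat (Suc n) * (Z3 ^ n :: 'a poly poly poly)"
    by (simp add: H_def)
  from arg_cong[OF this, of "\<lambda>A. eval3 A x y z"]
  have "(z - x) * eval3 (dZ3 (hcurve n)) x y z - (y ^ n - eval3 (hcurve n) x y z) = x ^ n - of_nat (Suc n) * z ^ n"
    by (simp only: eval3_simps)
  then show ?thesis
    by (simp add: algebra_simps)
qed

lemma smooth_closure_curve_poly_2:
  assumes k: "k \<ge> 2" and char: "CHAR('a::field) = 2"
  shows "smooth_closure (curve_poly 2 k :: 'a poly poly)"
proof -
  define n :: nat where "n = 2 ^ k - 1"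
  have n: "n \<ge> 2" "odd n"
    using power_increasing[of 2 k "2::nat"] k by (auto simp: n_def)
  have two: "of_nat m = (0::'a alg_closure) \<longleftrightarrow> even m" for m
    using char by (simp add: of_nat_eq_0_iff_char_dvd)
  have "x = 0 \<and> y = 0 \<and> z = 0"
    if G: "eval3 (hcurve n) x y z = 0" and GY: "eval3 (dY3 (hcurve n)) x y z = 0"
      and GZ: "eval3 (dZ3 (hcurve n)) x y z = 0" for x y z :: "'a alg_closure"
  proof -
    have "of_nat n * y ^ (n - 1) = 0"
      using GY by (simp only: eval3_dY3_hcurve)
    then have y: "y = 0"
      using two[of n] n by simp
    \<comment> \<open>Here \<open>Suc n\<close> is even; with y = 0 and both G and its z-derivative
      zero, only x^n remains in the derivative identity.\<close>
    have "of_nat (Suc n) = (0 :: 'a alg_closure)"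
      using two[of "Suc n"] n by (simp del: of_nat_Suc)
    then have "x ^ n = 0"
      using eval3_dZ3_hcurve[of x z n y, unfolded G GZ] n unfolding y by (simp add: power_0_left del: of_nat_Suc)
    then have x: "x = 0"
      by simp
    \<comment> \<open>At x = y = 0 the undifferentiated identity reduces to this.\<close>
    have "z * z ^ n = 0"
      using eval3_hcurve[of x z y n, unfolded G] n unfolding x y by (simp add: power_0_left)
    then have "z = 0"
      by auto
    with x y show ?thesis
      by simp
  qed
  moreover have "map_poly (map_poly (map_poly to_ac)) (homogenize (curve_poly 2 k :: 'a poly poly)) = hcurve n"
    using homogenize_curve_poly_2[of k, where 'a = 'a] k by (simp add: map_poly_hcurve n_def)
  ultimately show ?thesis
    unfolding smooth_closure_def Let_def by (metis (no_types))
qed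

section \<open>Points and lines of the projective plane\<close>

lemma proj_point_eqD:
  assumes "proj_point x y z = proj_point x' y' z'"
  shows "\<exists>c. c \<noteq> 0 \<and> x = c * x' \<and> y = c * y' \<and> z = c * z'"
proof -
  have "(x, y, z) \<in> proj_point x y z"
    by (auto simp: proj_point_def intro!: exI[of _ 1])
  then show ?thesis
    unfolding assms by (auto simp: proj_point_def)
qed

lemma proj_point_scale:
  assumes "c \<noteq> 0"
  shows "proj_point (c * x) (c * y) (c * z) = proj_point x y (z::'a::field)"
proof -
  have "\<exists>e. (d * x, d * y, d * z) = (e * (c * x), e * (c * y), e * (c * z)) \<and> e \<noteq> 0" if "d \<noteq> 0" for d
    using assms that by (intro exI[of _ "d / c"]) simp
  moreover have "\<exists>e. (d * (c * x), d * (c * y), d * (c * z)) = (e * x, e * y, e * z) \<and> e \<noteq> 0" if "d \<noteq> 0" for d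
    using assms that by (intro exI[of _ "d * c"]) (simp add: mult.assoc)
  ultimately show ?thesis
    unfolding proj_point_def by blast
qed

definition pline :: "'a::field \<Rightarrow> 'a \<Rightarrow> 'a \<Rightarrow> ('a \<times> 'a \<times> 'a) set set" where
  "pline a b c = {proj_point x y z | x y z. (x, y, z) \<noteq> (0, 0, 0) \<and> a * x + b * y + c * z = 0}"

text \<open>Two representatives of a point differ by a scalar, which factors out of the linear form;
  incidence can thus be tested on any representative.\<close>

lemma proj_point_in_pline_iff:
  assumes "(x, y, z) \<noteq> (0, 0, 0)"
  shows "proj_point x y z \<in> pline a b c \<longleftrightarrow> a * x + b * y + c * z = 0"
proof
  assume "proj_point x y z \<in> pline a b c"
  then obtain x' y' z' where eq: "proj_point x y z = proj_point x' y' z'"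
    and "a * x' + b * y' + c * z' = 0"
    by (auto simp: pline_def)
  moreover obtain t where "x = t * x'" "y = t * y'" "z = t * z'"
    using proj_point_eqD[OF eq] by blast
  moreover have "a * (t * x') + b * (t * y') + c * (t * z') = t * (a * x' + b * y' + c * z')"
    by (simp add: algebra_simps)
  ultimately show "a * x + b * y + c * z = 0"
    by simp
qed (use assms in \<open>auto simp: pline_def\<close>)

text \<open>The hypotheses \<open>cross\<close> say that the cross product vanishes. The scaling
  factor is the quotient at a coordinate where \<open>(u, v, w)\<close> is nonzero.\<close>

lemma proj_point_eqI:
  fixes x y z :: "'a::field"
  assumes nz: "(x, y, z) \<noteq> (0, 0, 0)" "(u, v, w) \<noteq> (0, 0, 0)"
    and cross: "x * v = y * u" "y * w = z * v" "x * w = z * u"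
  shows "proj_point x y z = proj_point u v w"
proof -
  have "\<exists>c. c \<noteq> 0 \<and> x = c * u \<and> y = c * v \<and> z = c * w"
  proof (cases "u = 0")
    case False
    then show ?thesis
      using nz cross by (intro exI[of _ "x / u"]) (auto simp: field_simps)
  next
    case u: True
    show ?thesis
    proof (cases "v = 0")
      case False
      then show ?thesis
        using nz cross u by (intro exI[of _ "y / v"]) (auto simp: field_simps)
    next
      case True
      then show ?thesis
        using nz cross u by (intro exI[of _ "z / w"]) (auto simp: field_simps)
    qed
  qed
  then show ?thesis
    by (auto simp: proj_point_scale)
qed

text \<open>A common point is orthogonal to both coefficient vectors, hence proportional to their
  nonzero cross product.\<close>

lemma card_pline_Int_le_1:
  fixes a b c a' b' c' :: "'a::{field,finite}"
  assumes "(b * c' - c * b', c * a' - a * c', a * b' - b * a') \<noteq> (0, 0, 0)"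
  shows "card (pline a b c \<inter> pline a' b' c') \<le> 1"
proof -
  define u v w where "u = b * c' - c * b'" and "v = c * a' - a * c'" and "w = a * b' - b * a'"
  have "pline a b c \<inter> pline a' b' c' \<subseteq> {proj_point u v w}"
  proof
    fix p assume p: "p \<in> pline a b c \<inter> pline a' b' c'"
    then obtain x y z where xyz: "p = proj_point x y z" "(x, y, z) \<noteq> (0, 0, 0)"
      by (auto simp: pline_def)
    have e: "a * x + b * y + c * z = 0" "a' * x + b' * y + c' * z = 0"
      using p xyz by (auto simp: proj_point_in_pline_iff)
    have "x * v - y * u = c * (a' * x + b' * y + c' * z) - c' * (a * x + b * y + c * z)"
      by (simp add: u_def v_def algebra_simps)
    moreover have "y * w - z * v = a * (a' * x + b' * y + c' * z) - a' * (a * x + b * y + c * z)"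
      by (simp add: w_def v_def algebra_simps)
    moreover have "x * w - z * u = b' * (a * x + b * y + c * z) - b * (a' * x + b' * y + c' * z)"
      by (simp add: u_def w_def algebra_simps)
    ultimately have "x * v = y * u" "y * w = z * v" "x * w = z * u"
      using e by auto
    then show "p \<in> {proj_point u v w}"
      unfolding xyz(1) singleton_iff using xyz(2) assms[folded u_def v_def w_def] by (intro proj_point_eqI)
  qed
  then show ?thesis
    using card_mono[of "{proj_point u v w}"] by simp
qed

section \<open>Rational points and failure of the arc property for q = 2\<close>

lemma rational_points_curve_poly_2:
  assumes k: "k \<ge> 1" and card: "CARD('a::{field,finite}) = 2 ^ k"
  shows "rational_points (curve_poly 2 k :: 'a poly poly) \<subseteq> pline 1 0 0 \<union> pline 0 1 0 \<union> pline 1 0 (- 1)"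
proof
  define n :: nat where "n = 2 ^ k - 1"
  fix p assume "p \<in> rational_points (curve_poly 2 k :: 'a poly poly)"
  then obtain x y z where p: "p = proj_point x y z" "(x, y, z) \<noteq> (0, 0, 0)"
    and "eval3 (hcurve n) x y z = 0"
    using k by (auto simp: rational_points_def homogenize_curve_poly_2 n_def)
  then have eq: "(x - z) * y ^ n = z * (x ^ n - z ^ n)"
    using eval3_hcurve[of x z y n] by simp
  have pow: "t ^ n = 1" if "t \<noteq> 0" for t :: 'a
    using finite_field_power_CARD[OF that] by (simp add: card n_def)
  \<comment> \<open>If z = 0 the equation reads x y^n = 0. If x and z are both nonzero, x^n = z^n =
    1 makes the right side vanish.\<close>
  have "x = 0 \<or> y = 0 \<or> x = z"
    using eq pow by (cases "z = 0") auto
  then show "p \<in> pline 1 0 0 \<union> pline 0 1 0 \<union> pline 1 0 (- 1)"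
    using p by (auto simp: proj_point_in_pline_iff)
qed

lemma not_has_arc_property_curve_poly_2:
  assumes k: "k \<ge> 3" and card: "CARD('a::{field,finite}) = 2 ^ k"
  shows "\<not> has_arc_property (curve_poly 2 k :: 'a poly poly)"
proof
  assume arc: "has_arc_property (curve_poly 2 k :: 'a poly poly)"
  define A where "A = rational_points (curve_poly 2 k :: 'a poly poly)"
  define d :: nat where "d = 2 ^ k - 1"
  have d: "d \<ge> 7"
    using power_increasing[of 3 k "2::nat"] k by (simp add: d_def)
  have A: "A \<subseteq> pline 1 0 0 \<union> pline 0 1 0 \<union> pline 1 0 (- 1)"
    using rational_points_curve_poly_2[OF _ card] k by (simp add: A_def)
  have complete: "is_complete_arc (card A) d A"
    using arc k by (simp add: has_arc_property_def A_def d_def total_degree_curve_poly_2)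
  then have is_arc: "is_arc (card A) d A"
    by (simp add: is_complete_arc_def)
  have "card {0, 1 :: 'a} < CARD('a)"
    using d by (simp add: card d_def)
  then have "{0, 1 :: 'a} \<noteq> UNIV"
    by (metis less_irrefl)
  then obtain t :: 'a where t: "t \<noteq> 0" "t \<noteq> 1"
    by blast
  define R where "R = proj_point t 1 1"
  have R_line: "R \<in> pline a b c \<longleftrightarrow> a * t + b + c = 0" for a b c
    by (simp add: R_def proj_point_in_pline_iff)
  have "R \<notin> A"
    using A t by (auto simp: R_line)
  have bound: "card (insert R A \<inter> L) \<le> d" if L: "L \<in> pg2_lines" for L
  proof (cases "R \<in> L")
    case False
    then show ?thesis
      using is_arc L by (simp add: is_arc_def)
  next
    case True
    obtain a b c where abc: "L = pline a b c" "(a, b, c) \<noteq> (0, 0, 0)"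
      using L by (auto simp: pg2_lines_def pline_def)
    have Rabc: "a * t + b + c = 0"
      using True abc R_line by simp
    \<comment> \<open>These say that \<open>L\<close> differs from the lines x = 0, y = 0 and x = z,
      as it contains \<open>R\<close> and they do not. They make the cross products below
      nonzero.\<close>
    have nd: "b \<noteq> 0 \<or> c \<noteq> 0" "a \<noteq> 0 \<or> c \<noteq> 0" "b \<noteq> 0 \<or> a + c \<noteq> 0"
    proof -
      show "b \<noteq> 0 \<or> c \<noteq> 0" "a \<noteq> 0 \<or> c \<noteq> 0"
        using Rabc abc(2) t by auto
      have "a * (t - 1) = 0" if "b = 0" "a + c = 0"
        using that Rabc by (simp add: algebra_simps eq_neg_iff_add_eq_0[symmetric])
      then show "b \<noteq> 0 \<or> a + c \<noteq> 0"
        using abc(2) t by auto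
    qed
    have "card (L \<inter> pline 1 0 0) \<le> 1" "card (L \<inter> pline 0 1 0) \<le> 1" "card (L \<inter> pline 1 0 (- 1)) \<le> 1"
      using nd card_pline_Int_le_1[where a = a and b = b and c = c and a' = 1 and b' = 0 and c' = 0]
        card_pline_Int_le_1[where a = a and b = b and c = c and a' = 0 and b' = 1 and c' = 0]
        card_pline_Int_le_1[where a = a and b = b and c = c and a' = 1 and b' = 0 and c' = "- 1"]
      unfolding abc(1) by (auto simp: add.commute)
    moreover have "insert R A \<inter> L \<subseteq>
        {R} \<union> ((L \<inter> pline 1 0 0) \<union> ((L \<inter> pline 0 1 0) \<union> (L \<inter> pline 1 0 (- 1))))"
      using A by blast
    then have "card (insert R A \<inter> L) \<le>
        card ({R} \<union> ((L \<inter> pline 1 0 0) \<union> ((L \<inter> pline 0 1 0) \<union> (L \<inter> pline 1 0 (- 1)))))"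
      by (intro card_mono) auto
    moreover have "\<dots> \<le> card {R} + (card (L \<inter> pline 1 0 0) + (card (L \<inter> pline 0 1 0) + card (L \<inter> pline 1 0 (- 1))))"
      by (intro order_trans[OF card_Un_le] add_left_mono order_refl)
    \<comment> \<open>The union bound gives 1 + 3 = 4 points, below 7 \<le> \<open>d\<close>; this
      is where k \<ge> 3 enters.\<close>
    ultimately show ?thesis
      using d by simp
  qed
  have "is_arc (card A + 1) d (insert R A)"
    unfolding is_arc_def
  proof (intro conjI)
    show "insert R A \<subseteq> pg2_points"
    proof -
      have "R \<in> pg2_points"
        unfolding pg2_points_def R_def by (rule CollectI, intro exI[of _ t] exI[of _ 1]) simp
      then show ?thesis
        using is_arc by (simp add: is_arc_def)
    qed
    show "card (insert R A) = card A + 1"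
      using \<open>R \<notin> A\<close> by simp
    show "\<forall>L\<in>pg2_lines. card (insert R A \<inter> L) \<le> d"
      using bound by blast
    obtain L where L: "L \<in> pg2_lines" "card (A \<inter> L) = d"
      using is_arc by (auto simp: is_arc_def)
    \<comment> \<open>A line meeting \<open>A\<close> in \<open>d\<close> points still does so after
      \<open>R\<close> is added: the count cannot drop, and \<open>bound\<close> keeps it at most
      \<open>d\<close>.\<close>
    have "card (A \<inter> L) \<le> card (insert R A \<inter> L)"
      by (intro card_mono) auto
    then show "\<exists>L\<in>pg2_lines. card (insert R A \<inter> L) = d"
      using L bound by (metis le_antisym)
  qed
  then show False
    using complete by (auto simp: is_complete_arc_def)
qed

theorem theorem6p2:
  fixes q k :: nat
  assumes "\<exists>m::nat. m \<ge> 1 \<and> q = 2 ^ m"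
    and "k \<ge> 3"
    and "CARD('a::{field,finite}) = q ^ k"
  shows "frobenius_nonclassical (curve_poly q k :: 'a poly poly) \<and>
    (q = 2 \<longrightarrow>
       smooth_closure (curve_poly q k :: 'a poly poly) \<and>
       \<not> has_arc_property (curve_poly q k :: 'a poly poly))"
proof -
  obtain m where m: "m \<ge> 1" "q = 2 ^ m"
    using assms(1) by blast
  then have q: "q \<ge> 2" "even q"
    using power_increasing[of 1 m "2::nat"] by auto
  have "CHAR('a) = 2"
    using assms(3) m by (intro CHAR_eq_2[of "m * k"]) (simp add: power_mult)
  then show ?thesis
    using frobenius_nonclassical_curve_poly[OF q _ assms(3)] smooth_closure_curve_poly_2[where 'a = 'a and k = k]
      not_has_arc_property_curve_poly_2[where 'a = 'a and k = k] assms(2,3)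
    by auto
qed

end
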